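(* Let $N\ge 2$. For every nonempty finite set $P\subset\mathbb{R}^N_{>0}$, $$R_2(P)=\int_{\mathbb{R}^N_{>0}\setminus U(b(P))}\frac{dx}{(x_1+\cdots+x_N)^{N+1}},$$ where $b(P)=\{b(p):p\in P\}$.
   Context: $\Delta_{N-1}=\{w\in\mathbb{R}^N_{\ge0}:w_1+\cdots+w_N=1\}$ is the weight simplex, equipped with the measure $dw=dw_1\cdots dw_{N-1}$ (Lebesgue measure in the first $N-1$ coordinates, so the total volume is $1/(N-1)!$). For $p\in\mathbb{R}^N_{>0}$, $g_p(w)=\max_{i=1,\ldots,N}w_ip_i$. For a finite nonempty $P\subset\mathbb{R}^N_{>0}$, $\tau_P(w)=\min_{p\in P}g_p(w)$ and the (unnormalised) integral $R_2$ value is $R_2(P)=\int_{\Delta_{N-1}}\tau_P(w)\,dw$. For $p\in\mathbb{R}^N_{>0}$, $b(p)=(1/p_1,\ldots,1/p_N)$. For a set $Q\subset\mathbb{R}^N_{>0}$, $U(Q)=\bigcup_{q\in Q}\prod_{i=1}^N[0,q_i]$ is the anchored-box union. *)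

theory Defs
  imports "HOL-Analysis.Analysis"
begin

text \<open>A vector of \<open>\<real>\<^sup>N\<close> is a function on the index set \<open>{1..N}\<close> that is \<^const>\<open>undefined\<close>
  elsewhere, i.e. an element of \<open>{1..N} \<rightarrow>\<^sub>E UNIV\<close>.\<close>

definition pos_orthant :: "nat \<Rightarrow> (nat \<Rightarrow> real) set" where
  "pos_orthant N = {1..N} \<rightarrow>\<^sub>E {0<..}"

definition weight_simplex :: "nat \<Rightarrow> (nat \<Rightarrow> real) set" where
  "weight_simplex N = {w \<in> {1..N} \<rightarrow>\<^sub>E {0..}. (\<Sum>i=1..N. w i) = 1}"

abbreviation lebesgue_on_indices :: "nat set \<Rightarrow> (nat \<Rightarrow> real) measure" where
  "lebesgue_on_indices I \<equiv> Pi\<^sub>M I (\<lambda>_. lborel)"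

text \<open>The measure \<open>dw\<^sub>1 \<cdots> dw\<^bsub>N-1\<^esub>\<close> on the hyperplane \<open>w\<^sub>1 + \<cdots> + w\<^sub>N = 1\<close>: Lebesgue measure in the
  first \<open>N - 1\<close> coordinates, transported to \<open>\<real>\<^sup>N\<close> by solving for the last one.\<close>

definition hyperplane_measure :: "nat \<Rightarrow> (nat \<Rightarrow> real) measure" where
  "hyperplane_measure N =
     distr (lebesgue_on_indices {1..<N}) (lebesgue_on_indices {1..N})
       (\<lambda>v. v(N := 1 - (\<Sum>i=1..<N. v i)))"

definition weighted_max :: "nat \<Rightarrow> (nat \<Rightarrow> real) \<Rightarrow> (nat \<Rightarrow> real) \<Rightarrow> real" where
  "weighted_max N p w = (MAX i\<in>{1..N}. w i * p i)"

definition lower_envelope :: "nat \<Rightarrow> (nat \<Rightarrow> real) set \<Rightarrow> (nat \<Rightarrow> real) \<Rightarrow> real" where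
  "lower_envelope N P w = (MIN p\<in>P. weighted_max N p w)"

definition R2 :: "nat \<Rightarrow> (nat \<Rightarrow> real) set \<Rightarrow> real" where
  "R2 N P = (LINT w:weight_simplex N|hyperplane_measure N. lower_envelope N P w)"

definition recip :: "nat \<Rightarrow> (nat \<Rightarrow> real) \<Rightarrow> (nat \<Rightarrow> real)" where
  "recip N p = (\<lambda>i\<in>{1..N}. 1 / p i)"

definition anchored_box_union :: "nat \<Rightarrow> (nat \<Rightarrow> real) set \<Rightarrow> (nat \<Rightarrow> real) set" where
  "anchored_box_union N Q = (\<Union>q\<in>Q. \<Pi>\<^sub>E i\<in>{1..N}. {0..q i})"

lemma measurable_hyperplane_chart [measurable]:
  assumes "N \<ge> 1"
  shows "(\<lambda>v. v(N := 1 - (\<Sum>i=1..<N. v i)))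
           \<in> measurable (lebesgue_on_indices {1..<N}) (lebesgue_on_indices {1..N})"
proof -
  have "{1..N} = insert N {1..<N}" using assms by auto
  then show ?thesis
    by (auto intro!: measurable_fun_upd[where J = "{1..<N}"])
qed

lemma sets_weight_simplex [measurable]:
  "weight_simplex N \<in> sets (lebesgue_on_indices {1..N})"
proof -
  have "weight_simplex N =
      ({1..N} \<rightarrow>\<^sub>E {0..}) \<inter> (\<lambda>w. \<Sum>i=1..N. w i) -` {1} \<inter> space (lebesgue_on_indices {1..N})"
    by (auto simp: weight_simplex_def space_PiM)
  also have "\<dots> \<in> sets (lebesgue_on_indices {1..N})"
    by measurable
  finally show ?thesis .
qed

lemma emeasure_weight_simplex:
  assumes "N \<ge> 1"
  shows "emeasure (hyperplane_measure N) (weight_simplex N) = ennreal (1 / fact (N - 1))"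
proof -
  have N: "{1..N} = insert N {1..<N}" using assms by auto
  have eq: "(\<lambda>v. v(N := 1 - (\<Sum>i=1..<N. v i))) -` weight_simplex N \<inter> space (lebesgue_on_indices {1..<N})
     = {v. (\<forall>i\<in>{1..<N}. 0 \<le> v i) \<and> sum v {1..<N} \<le> 1} \<inter> space (lebesgue_on_indices {1..<N})"
    (is "?L = ?R")
  proof (rule set_eqI)
    fix v :: "nat \<Rightarrow> real"
    let ?u = "v(N := 1 - (\<Sum>i=1..<N. v i))"
    have s: "(\<Sum>i=1..N. ?u i) = 1"
      unfolding N by simp
    have "?u \<in> weight_simplex N \<longleftrightarrow> (\<forall>i\<in>{1..<N}. 0 \<le> v i) \<and> sum v {1..<N} \<le> 1"
      if "v \<in> extensional {1..<N}"
    proof -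
      have "?u \<in> extensional {1..N}"
        using that assms by (auto simp: extensional_def)
      then have "?u \<in> weight_simplex N \<longleftrightarrow> (\<forall>i\<in>{1..N}. 0 \<le> ?u i)"
        using s unfolding weight_simplex_def PiE_def Pi_def atLeast_iff mem_Collect_eq Int_iff by blast
      also have "\<dots> \<longleftrightarrow> (\<forall>i\<in>{1..<N}. 0 \<le> v i) \<and> sum v {1..<N} \<le> 1"
        unfolding N by auto
      finally show ?thesis .
    qed
    then show "v \<in> ?L \<longleftrightarrow> v \<in> ?R"
      by (auto simp: space_PiM PiE_def)
  qed
  have "emeasure (hyperplane_measure N) (weight_simplex N) = emeasure (lebesgue_on_indices {1..<N}) ?R"
    unfolding hyperplane_measure_def eq[symmetric]
    by (intro emeasure_distr measurable_hyperplane_chart assms sets_weight_simplex)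
  also have "\<dots> = ennreal (1 / fact (N - 1))"
    using emeasure_std_simplex_aux[of "{1..<N}" 1] by simp
  finally show ?thesis .
qed

end

theory Submission
  imports Defs
begin

text \<open>In the cone coordinates \<open>x = r w\<close> with \<open>r = x\<^sub>1 + \<cdots> + x\<^sub>N\<close> and \<open>w\<close> in the simplex one has
  \<open>dx = r\<^bsup>N-1\<^esup> dr dw\<close>, and a point \<open>r w\<close> of the open orthant avoids every box \<open>[0, b(p)]\<close> iff
  \<open>r \<tau>\<^sub>P(w) > 1\<close>. The integral over the ray through \<open>w\<close> is therefore the integral of \<open>r\<^sup>-\<^sup>2\<close> over
  \<open>r > 1 / \<tau>\<^sub>P(w)\<close>, which is \<open>\<tau>\<^sub>P(w)\<close>.\<close>

section \<open>Cone coordinates for Lebesgue measure on the product space\<close>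

interpretation lborel_product: product_sigma_finite "\<lambda>_::nat. lborel :: real measure"
  by standard

text \<open>Tonelli peels off one coordinate at a time, and each one-dimensional substitution
  \<open>y \<mapsto> r * y\<close> contributes one factor \<open>r\<close>. The scaling is later
  applied to the \<open>N - 1\<close> free coordinates of a slice of constant coordinate
  sum.\<close>

lemma nn_integral_PiM_lborel_scale:
  fixes f :: "(nat \<Rightarrow> real) \<Rightarrow> ennreal"
  assumes "finite I" and "r > 0" and "f \<in> borel_measurable (lebesgue_on_indices I)"
  shows "(\<integral>\<^sup>+v. f v \<partial>lebesgue_on_indices I)
       = ennreal (r ^ card I) * (\<integral>\<^sup>+u. f (\<lambda>i\<in>I. r * u i) \<partial>lebesgue_on_indices I)"
  using assms(1,3)
proof (induction I arbitrary: f rule: finite_induct)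
  case empty
  then show ?case
    by (simp add: PiM_empty nn_integral_count_space_finite restrict_def)
next
  case (insert j I)
  note [measurable] = insert.prems
  have upd [measurable]: "(\<lambda>(v, y). v(j := y)) \<in>
      lebesgue_on_indices I \<Otimes>\<^sub>M lborel \<rightarrow>\<^sub>M lebesgue_on_indices (insert j I)"
    by (rule measurable_add_dim)
  have scl [measurable]: "(\<lambda>u. \<lambda>i\<in>J. r * u i) \<in> lebesgue_on_indices J \<rightarrow>\<^sub>M lebesgue_on_indices J" for J
    by (rule measurable_restrict) measurable
  have m2: "(\<lambda>(v, y). f (v(j := y))) \<in> borel_measurable (lebesgue_on_indices I \<Otimes>\<^sub>M lborel)"
    using measurable_compose[OF upd insert.prems] by (simp add: case_prod_unfold)
  have m3: "(\<lambda>(v, y). f (v(j := r * y))) \<in> borel_measurable (lebesgue_on_indices I \<Otimes>\<^sub>M lborel)"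
  proof -
    have "(\<lambda>(v, y). (v, r * y)) \<in> lebesgue_on_indices I \<Otimes>\<^sub>M lborel \<rightarrow>\<^sub>M lebesgue_on_indices I \<Otimes>\<^sub>M (lborel :: real measure)"
      by measurable
    from measurable_compose[OF this m2] show ?thesis by (simp add: case_prod_unfold)
  qed
  have m1: "(\<lambda>y. f (v(j := y))) \<in> borel_measurable lborel" if "v \<in> space (lebesgue_on_indices I)" for v
    using measurable_compose[OF measurable_Pair1'[OF that] m2] by simp
  have m4: "(\<lambda>v. \<integral>\<^sup>+y. f (v(j := r * y)) \<partial>lborel) \<in> borel_measurable (lebesgue_on_indices I)"
    using lborel.borel_measurable_nn_integral[OF m3] by simp
  have "(\<integral>\<^sup>+v. f v \<partial>lebesgue_on_indices (insert j I))
      = (\<integral>\<^sup>+v. \<integral>\<^sup>+y. f (v(j := y)) \<partial>lborel \<partial>lebesgue_on_indices I)"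
    using insert.hyps insert.prems by (intro lborel_product.product_nn_integral_insert) auto
  also have "\<dots> = (\<integral>\<^sup>+v. ennreal r * (\<integral>\<^sup>+y. f (v(j := r * y)) \<partial>lborel) \<partial>lebesgue_on_indices I)"
    using \<open>r > 0\<close> by (intro nn_integral_cong) (subst nn_integral_real_affine[where c = r and t = 0], use m1 in auto)
  also have "\<dots> = ennreal r * (\<integral>\<^sup>+v. (\<integral>\<^sup>+y. f (v(j := r * y)) \<partial>lborel) \<partial>lebesgue_on_indices I)"
    using m4 by (rule nn_integral_cmult)
  \<comment> \<open>The induction hypothesis is applied to the integral over the already rescaled
    coordinate \<open>j\<close>, as a function of the other coordinates; this is why
    \<open>f\<close> is arbitrary in the induction.\<close>
  also have "(\<integral>\<^sup>+v. (\<integral>\<^sup>+y. f (v(j := r * y)) \<partial>lborel) \<partial>lebesgue_on_indices I)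
      = ennreal (r ^ card I) *
        (\<integral>\<^sup>+u. (\<integral>\<^sup>+y. f ((\<lambda>i\<in>I. r * u i)(j := r * y)) \<partial>lborel) \<partial>lebesgue_on_indices I)"
    by (rule insert.IH[OF m4])
  also have "(\<integral>\<^sup>+u. (\<integral>\<^sup>+y. f ((\<lambda>i\<in>I. r * u i)(j := r * y)) \<partial>lborel) \<partial>lebesgue_on_indices I)
      = (\<integral>\<^sup>+u. (\<integral>\<^sup>+y. f (\<lambda>i\<in>insert j I. r * (u(j := y)) i) \<partial>lborel) \<partial>lebesgue_on_indices I)"
    using insert.hyps by (intro nn_integral_cong arg_cong[where f = f]) (auto simp: restrict_def)
  also have "\<dots> = (\<integral>\<^sup>+u. f (\<lambda>i\<in>insert j I. r * u i) \<partial>lebesgue_on_indices (insert j I))"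
    using insert.hyps measurable_compose[OF scl insert.prems]
    by (intro lborel_product.product_nn_integral_insert[symmetric]) auto
  finally have "(\<integral>\<^sup>+v. f v \<partial>lebesgue_on_indices (insert j I)) = ennreal r * (ennreal (r ^ card I) *
      (\<integral>\<^sup>+u. f (\<lambda>i\<in>insert j I. r * u i) \<partial>lebesgue_on_indices (insert j I)))" .
  moreover have "ennreal (r ^ card (insert j I)) = ennreal r * ennreal (r ^ card I)"
    using insert.hyps \<open>r > 0\<close> by (simp add: ennreal_mult)
  ultimately show ?case
    by (simp only: mult.assoc)
qed

text \<open>Replacing the last coordinate by the coordinate sum \<open>r\<close> is a shear and
  preserves volume. For fixed \<open>r > 0\<close>, rescaling the remaining \<open>N - 1\<close>
  coordinates by \<open>r\<close> turns the slice of sum \<open>r\<close> into the slice of sum 1,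
  at the price of \<open>r ^ (N - 1)\<close>. By \<open>supp\<close> the slices with
  \<open>r \<le> 0\<close> contribute nothing. Here \<open>w\<close> ranges over the whole
  hyperplane, not only over the simplex.\<close>

lemma nn_integral_cone_coordinates:
  fixes f :: "(nat \<Rightarrow> real) \<Rightarrow> ennreal"
  assumes N: "N \<ge> 1" and f: "f \<in> borel_measurable (lebesgue_on_indices {1..N})"
    and supp: "\<And>x. (\<Sum>i=1..N. x i) \<le> 0 \<Longrightarrow> f x = 0"
  shows "(\<integral>\<^sup>+x. f x \<partial>lebesgue_on_indices {1..N})
       = (\<integral>\<^sup>+w. (\<integral>\<^sup>+r. ennreal (r ^ (N - 1)) * f (\<lambda>i\<in>{1..N}. r * w i) * indicator {0<..} r \<partial>lborel)
           \<partial>hyperplane_measure N)"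
proof -
  have NI: "{1..N} = insert N {1..<N}" using N by auto
  let ?L = "lebesgue_on_indices {1..<N}"
  let ?chart = "\<lambda>v :: nat \<Rightarrow> real. v(N := 1 - (\<Sum>i=1..<N. v i))"
  interpret L: sigma_finite_measure ?L
    by (rule lborel_product.sigma_finite) simp
  interpret pair_sigma_finite "lborel :: real measure" ?L ..
  have slice: "(\<lambda>(r, v). v(N := r - (\<Sum>i=1..<N. v i))) \<in> lborel \<Otimes>\<^sub>M ?L \<rightarrow>\<^sub>M lebesgue_on_indices {1..N}"
    unfolding case_prod_unfold
    by (rule measurable_fun_upd[where J = "{1..<N}"]) (use NI in auto)
  have fslice: "(\<lambda>(r, v). f (v(N := r - (\<Sum>i=1..<N. v i)))) \<in> borel_measurable (lborel \<Otimes>\<^sub>M ?L)"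
    using measurable_compose[OF slice f] by (simp add: case_prod_unfold)
  have ray: "(\<lambda>(r, w). \<lambda>i\<in>{1..N}. r * w i) \<in>
      lborel \<Otimes>\<^sub>M lebesgue_on_indices {1..N} \<rightarrow>\<^sub>M lebesgue_on_indices {1..N}"
    unfolding case_prod_unfold by (rule measurable_restrict) measurable
  have fray: "(\<lambda>(r, w). ennreal (r ^ (N - 1)) * f (\<lambda>i\<in>{1..N}. r * w i) * indicator {0<..} r)
      \<in> borel_measurable (lborel \<Otimes>\<^sub>M lebesgue_on_indices {1..N})"
    using measurable_compose[OF ray f] unfolding case_prod_unfold by measurable
  have chart: "(\<lambda>(r, v). (r, ?chart v)) \<in> lborel \<Otimes>\<^sub>M ?L \<rightarrow>\<^sub>M (lborel::real measure) \<Otimes>\<^sub>M lebesgue_on_indices {1..N}"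
    using measurable_compose[OF measurable_snd measurable_hyperplane_chart[OF N]]
    unfolding case_prod_unfold by measurable
  have fchart: "(\<lambda>(r, v). ennreal (r ^ (N - 1)) * f (\<lambda>i\<in>{1..N}. r * ?chart v i) * indicator {0<..} r)
      \<in> borel_measurable (lborel \<Otimes>\<^sub>M ?L)"
    using measurable_compose[OF chart fray] by (simp add: case_prod_unfold)
  have inner: "(\<lambda>w. \<integral>\<^sup>+r. ennreal (r ^ (N - 1)) * f (\<lambda>i\<in>{1..N}. r * w i) * indicator {0<..} r \<partial>lborel)
      \<in> borel_measurable (lebesgue_on_indices {1..N})"
    using lborel.borel_measurable_nn_integral[of "\<lambda>w r. ennreal (r ^ (N - 1)) * f (\<lambda>i\<in>{1..N}. r * w i) * indicator {0<..} r"]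
      measurable_compose[OF measurable_pair_swap' fray] by (simp add: case_prod_unfold)
  have "(\<integral>\<^sup>+x. f x \<partial>lebesgue_on_indices {1..N}) = (\<integral>\<^sup>+v. \<integral>\<^sup>+y. f (v(N := y)) \<partial>lborel \<partial>?L)"
    unfolding NI using f[unfolded NI] by (intro lborel_product.product_nn_integral_insert) auto
  \<comment> \<open>For fixed \<open>v\<close> this is a translation of the last coordinate; the new
    variable \<open>r\<close> is the sum of all coordinates.\<close>
  also have "\<dots> = (\<integral>\<^sup>+v. \<integral>\<^sup>+r. f (v(N := r - (\<Sum>i=1..<N. v i))) \<partial>lborel \<partial>?L)"
  proof (rule nn_integral_cong)
    fix v assume v: "v \<in> space ?L"
    have "(\<lambda>y. v(N := y)) \<in> lborel \<rightarrow>\<^sub>M lebesgue_on_indices {1..N}"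
      using v by (intro measurable_fun_upd[where J = "{1..<N}"]) (use NI in auto)
    then have "(\<lambda>y. f (v(N := y))) \<in> borel_measurable borel"
      using measurable_compose[OF _ f] by simp
    then show "(\<integral>\<^sup>+y. f (v(N := y)) \<partial>lborel) = (\<integral>\<^sup>+r. f (v(N := r - (\<Sum>i=1..<N. v i))) \<partial>lborel)"
      by (subst nn_integral_real_affine[where c = 1 and t = "- (\<Sum>i=1..<N. v i)"]) auto
  qed
  \<comment> \<open>The radius moves outside so that it is constant while \<open>v\<close> is
    rescaled; the order is restored once that is done.\<close>
  also have "\<dots> = (\<integral>\<^sup>+r. \<integral>\<^sup>+v. f (v(N := r - (\<Sum>i=1..<N. v i))) \<partial>?L \<partial>lborel)"
    using Fubini'[OF fslice] by simp
  also have "\<dots> = (\<integral>\<^sup>+r. \<integral>\<^sup>+v. ennreal (r ^ (N - 1)) * f (\<lambda>i\<in>{1..N}. r * ?chart v i) * indicator {0<..} r \<partial>?L \<partial>lborel)"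
  proof (rule nn_integral_cong)
    fix r :: real
    show "(\<integral>\<^sup>+v. f (v(N := r - (\<Sum>i=1..<N. v i))) \<partial>?L)
        = (\<integral>\<^sup>+v. ennreal (r ^ (N - 1)) * f (\<lambda>i\<in>{1..N}. r * ?chart v i) * indicator {0<..} r \<partial>?L)"
    proof (cases "r > 0")
      case False
      have "(\<Sum>i=1..N. (v(N := r - (\<Sum>i=1..<N. v i))) i) = r" for v :: "nat \<Rightarrow> real"
        unfolding NI by simp
      with False have "f (v(N := r - (\<Sum>i=1..<N. v i))) = 0" for v
        by (intro supp) simp
      then show ?thesis using False by simp
    next
      case True
      have m: "(\<lambda>v. f (v(N := r - (\<Sum>i=1..<N. v i)))) \<in> borel_measurable ?L"
        using measurable_compose[OF measurable_Pair1' fslice, of r] by simp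
      have m': "(\<lambda>v. f (\<lambda>i\<in>{1..N}. r * ?chart v i)) \<in> borel_measurable ?L"
        using measurable_compose[OF measurable_hyperplane_chart[OF N]
            measurable_compose[OF measurable_Pair1' measurable_compose[OF ray f], of r]] by simp
      \<comment> \<open>The last coordinate scales along with the others because
        \<open>r - r * s = r * (1 - s)\<close>, where \<open>s\<close> is the sum of the
        \<open>v i\<close>.\<close>
      have pt: "(\<lambda>i\<in>{1..<N}. r * v i)(N := r - (\<Sum>i=1..<N. (\<lambda>i\<in>{1..<N}. r * v i) i))
          = (\<lambda>i\<in>{1..N}. r * ?chart v i)" for v :: "nat \<Rightarrow> real"
        unfolding NI by (auto simp: restrict_def sum_distrib_left right_diff_distrib fun_eq_iff)
      have "(\<integral>\<^sup>+v. f (v(N := r - (\<Sum>i=1..<N. v i))) \<partial>?L)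
          = ennreal (r ^ card {1..<N}) * (\<integral>\<^sup>+v. f (\<lambda>i\<in>{1..N}. r * ?chart v i) \<partial>?L)"
        by (subst nn_integral_PiM_lborel_scale[OF _ True m]) (simp_all only: pt finite_atLeastLessThan)
      also have "\<dots> = (\<integral>\<^sup>+v. ennreal (r ^ (N - 1)) * f (\<lambda>i\<in>{1..N}. r * ?chart v i) \<partial>?L)"
        using m' by (simp add: nn_integral_cmult)
      finally show ?thesis using True by simp
    qed
  qed
  also have "\<dots> = (\<integral>\<^sup>+v. \<integral>\<^sup>+r. ennreal (r ^ (N - 1)) * f (\<lambda>i\<in>{1..N}. r * ?chart v i) * indicator {0<..} r \<partial>lborel \<partial>?L)"
    using Fubini'[OF fchart] by simp
  also have "\<dots> = (\<integral>\<^sup>+w. (\<integral>\<^sup>+r. ennreal (r ^ (N - 1)) * f (\<lambda>i\<in>{1..N}. r * w i) * indicator {0<..} r \<partial>lborel)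
           \<partial>hyperplane_measure N)"
    unfolding hyperplane_measure_def
    using inner by (subst nn_integral_distr[OF measurable_hyperplane_chart[OF N]]) simp_all
  finally show ?thesis .
qed

section \<open>Null sets of the product and hyperplane measures\<close>

lemma AE_PiM_lborel_coordinate_neq:
  fixes c :: real
  assumes "finite I" and "i \<in> I"
  shows "AE v in lebesgue_on_indices I. v i \<noteq> c"
proof (rule AE_I)
  \<comment> \<open>A box with one side collapsed to a point: its volume is a product with a factor
    0, which absorbs the infinite factors of the other sides.\<close>
  let ?Z = "\<Pi>\<^sub>E j\<in>I. if j = i then {c} else UNIV"
  show "{v \<in> space (lebesgue_on_indices I). \<not> v i \<noteq> c} \<subseteq> ?Z"
    by (auto simp: space_PiM PiE_def)
  show "?Z \<in> sets (lebesgue_on_indices I)"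
    using assms by (intro sets_PiM_I_finite) auto
  have "emeasure (lebesgue_on_indices I) ?Z = (\<Prod>j\<in>I. emeasure lborel (if j = i then {c} else UNIV))"
    using assms by (intro lborel_product.emeasure_PiM) auto
  also have "\<dots> = 0"
    using assms by (auto intro!: prod_zero bexI[of _ i])
  finally show "emeasure (lebesgue_on_indices I) ?Z = 0" .
qed

text \<open>Every line parallel to the axis of \<open>i\<close> meets the hyperplane in exactly one
  point, so Tonelli with coordinate \<open>i\<close> integrated first gives measure 0.\<close>

lemma AE_PiM_lborel_sum_neq:
  fixes c :: real
  assumes "finite I" and "i \<in> I"
  shows "AE v in lebesgue_on_indices I. (\<Sum>j\<in>I. v j) \<noteq> c"
proof -
  let ?J = "I - {i}"
  have I: "I = insert i ?J" using assms by auto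
  have "emeasure (lebesgue_on_indices I) {v \<in> space (lebesgue_on_indices I). (\<Sum>j\<in>I. v j) = c}
      = (\<integral>\<^sup>+v. indicator {v \<in> space (lebesgue_on_indices I). (\<Sum>j\<in>I. v j) = c} v \<partial>lebesgue_on_indices I)"
    by simp
  also have "\<dots> = (\<integral>\<^sup>+v. indicator {v. (\<Sum>j\<in>I. v j) = c} v \<partial>lebesgue_on_indices I)"
    by (rule nn_integral_cong) (simp add: indicator_def)
  also have "\<dots> = (\<integral>\<^sup>+v. \<integral>\<^sup>+y. indicator {v. (\<Sum>j\<in>I. v j) = c} (v(i := y)) \<partial>lborel
      \<partial>lebesgue_on_indices ?J)"
  proof -
    have "(\<lambda>v. indicator {v. (\<Sum>j\<in>I. v j) = c} v :: ennreal) \<in> borel_measurable (lebesgue_on_indices I)"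
      unfolding indicator_def mem_Collect_eq by measurable
    then show ?thesis
      using assms lborel_product.product_nn_integral_insert[of ?J i "indicator {v. (\<Sum>j\<in>I. v j) = c}",
          folded I]
      by simp
  qed
  also have "\<dots> = (\<integral>\<^sup>+v. \<integral>\<^sup>+y. indicator {c - (\<Sum>j\<in>?J. v j)} y \<partial>lborel \<partial>lebesgue_on_indices ?J)"
  proof (intro nn_integral_cong)
    fix v :: "nat \<Rightarrow> real" and y :: real
    have "(\<Sum>j\<in>I. (v(i := y)) j) = y + (\<Sum>j\<in>?J. v j)"
      using assms by (simp add: sum.remove[of I i])
    then show "indicator {v. (\<Sum>j\<in>I. v j) = c} (v(i := y))
        = (indicator {c - (\<Sum>j\<in>?J. v j)} y :: ennreal)"
      by (auto simp: indicator_def)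
  qed
  also have "\<dots> = 0"
    by simp
  finally show ?thesis
    by (subst AE_iff_measurable[OF _ refl]) auto
qed

text \<open>On the boundary of the simplex the ray identity breaks down: the ray misses the open
  orthant, while the envelope is still positive. This lemma makes such \<open>w\<close>
  negligible.\<close>

lemma AE_hyperplane_coordinate_neq_0:
  assumes "N \<ge> 2"
  shows "AE w in hyperplane_measure N. \<forall>i\<in>{1..N}. w i \<noteq> 0"
proof -
  let ?L = "lebesgue_on_indices {1..<N}"
  have "AE v in ?L. \<forall>i\<in>{1..<N}. v i \<noteq> 0"
    by (intro AE_finite_allI AE_PiM_lborel_coordinate_neq) auto
  \<comment> \<open>This is the last coordinate of the chart being nonzero. The index 1 lies in
    \<open>{1..<N}\<close> because \<open>N \<ge> 2\<close>.\<close>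
  moreover have "AE v in ?L. (\<Sum>i=1..<N. v i) \<noteq> 1"
    using assms by (intro AE_PiM_lborel_sum_neq[where i = 1]) auto
  ultimately have "AE v in ?L. \<forall>i\<in>{1..N}. (v(N := 1 - (\<Sum>i=1..<N. v i))) i \<noteq> 0"
    by eventually_elim auto
  moreover have "{w \<in> space (lebesgue_on_indices {1..N}). \<forall>i\<in>{1..N}. w i \<noteq> 0}
      \<in> sets (lebesgue_on_indices {1..N})"
    by measurable
  ultimately show ?thesis
    unfolding hyperplane_measure_def
    using assms by (subst AE_distr_iff[OF measurable_hyperplane_chart]) auto
qed

lemma AE_hyperplane_sum_eq_1:
  assumes "N \<ge> 1"
  shows "AE w in hyperplane_measure N. (\<Sum>i=1..N. w i) = 1"
proof -
  have NI: "{1..N} = insert N {1..<N}" using assms by auto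
  have "(\<Sum>i=1..N. (v(N := 1 - (\<Sum>i=1..<N. v i))) i) = 1" for v :: "nat \<Rightarrow> real"
    unfolding NI by simp
  then show ?thesis
    unfolding hyperplane_measure_def
    using assms by (subst AE_distr_iff[OF measurable_hyperplane_chart]) auto
qed

section \<open>The radial tail integral and the geometry of the envelope\<close>

lemma nn_integral_inverse_square_tail:
  fixes a :: real
  assumes "a > 0"
  shows "(\<integral>\<^sup>+r. ennreal (1 / r ^ 2) * indicator {a<..} r \<partial>lborel) = ennreal (1 / a)"
proof -
  \<comment> \<open>The endpoint is a null set; adding it gives the closed half-line on which the
    fundamental theorem is applied.\<close>
  have "(\<integral>\<^sup>+r. ennreal (1 / r ^ 2) * indicator {a<..} r \<partial>lborel)
      = (\<integral>\<^sup>+r. ennreal (1 / r ^ 2) * indicator {a..} r \<partial>lborel)"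
  proof (rule nn_integral_cong_AE)
    show "AE r in lborel. ennreal (1 / r ^ 2) * indicator {a<..} r = ennreal (1 / r ^ 2) * indicator {a..} r"
      using AE_lborel_singleton[of a] by eventually_elim (auto simp: indicator_def)
  qed
  also have "\<dots> = ennreal (0 - (- 1 / a))"
  proof (rule nn_integral_FTC_atLeast)
    show "((\<lambda>r. - 1 / r) has_real_derivative 1 / r ^ 2) (at r)" if "a \<le> r" for r
      using that assms by (auto intro!: derivative_eq_intros simp: power2_eq_square)
    show "((\<lambda>r::real. - 1 / r) \<longlongrightarrow> 0) at_top"
      by real_asymp
  qed auto
  finally show ?thesis by simp
qed

lemma borel_measurable_lower_envelope:
  assumes "finite P"
  shows "lower_envelope N P \<in> borel_measurable (lebesgue_on_indices {1..N})"
  unfolding lower_envelope_def weighted_max_def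
  using assms by measurable

text \<open>A minimum of maxima exceeds \<open>1 / r\<close> iff every \<open>p\<close> has a
  coordinate with \<open>r * w i > 1 / p i\<close>, that is, iff the point leaves every box through
  some upper face. The strict inequality matches the closed boxes. Positivity of \<open>w\<close>
  takes care of the orthant and of the lower faces.\<close>

lemma one_less_mult_lower_envelope_iff:
  assumes "N \<ge> 1" and "finite P" and "P \<noteq> {}" and "P \<subseteq> pos_orthant N"
    and "r > 0" and w: "\<And>i. i \<in> {1..N} \<Longrightarrow> 0 < w i"
  shows "1 < r * lower_envelope N P w \<longleftrightarrow>
    (\<lambda>i\<in>{1..N}. r * w i) \<in> pos_orthant N - anchored_box_union N (recip N ` P)"
proof -
  have *: "1 / r < w i * p i \<longleftrightarrow> \<not> r * w i \<le> 1 / p i" if "p \<in> P" "i \<in> {1..N}" for p i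
  proof -
    have "p i > 0" using that assms(4) by (auto simp: pos_orthant_def PiE_def Pi_def)
    with \<open>r > 0\<close> show ?thesis by (auto simp: field_simps)
  qed
  have "1 < r * lower_envelope N P w \<longleftrightarrow> 1 / r < lower_envelope N P w"
    using \<open>r > 0\<close> by (simp add: field_simps)
  also have "\<dots> \<longleftrightarrow> (\<forall>p\<in>P. \<exists>i\<in>{1..N}. 1 / r < w i * p i)"
    unfolding lower_envelope_def weighted_max_def
    using assms by (subst Min_gr_iff; simp) (subst Max_gr_iff; simp)
  also have "\<dots> \<longleftrightarrow> (\<forall>p\<in>P. \<exists>i\<in>{1..N}. \<not> r * w i \<le> 1 / p i)"
    using * by blast
  also have "\<dots> \<longleftrightarrow> (\<lambda>i\<in>{1..N}. r * w i) \<in> pos_orthant N - anchored_box_union N (recip N ` P)"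
    using \<open>r > 0\<close> w
    by (auto simp: pos_orthant_def anchored_box_union_def recip_def PiE_iff less_imp_le)
  finally show ?thesis .
qed

section \<open>Bounds on the envelope and finiteness of its integral\<close>

lemma weighted_max_nonneg:
  assumes "N \<ge> 1" and "p \<in> pos_orthant N" and "w \<in> weight_simplex N"
  shows "0 \<le> weighted_max N p w"
proof -
  have "0 \<le> w 1 * p 1"
    using assms by (auto simp: pos_orthant_def weight_simplex_def PiE_iff less_imp_le)
  also have "\<dots> \<le> weighted_max N p w"
    unfolding weighted_max_def using assms(1) by (intro Max_ge) auto
  finally show ?thesis .
qed

lemma weighted_max_le_sum:
  assumes "N \<ge> 1" and "p \<in> pos_orthant N" and w: "w \<in> weight_simplex N"
  shows "weighted_max N p w \<le> (\<Sum>i=1..N. p i)"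
proof -
  have p: "0 \<le> p i" if "i \<in> {1..N}" for i
    using that assms by (auto simp: pos_orthant_def PiE_iff less_imp_le)
  have "w i * p i \<le> (\<Sum>i=1..N. p i)" if i: "i \<in> {1..N}" for i
  proof -
    have "w i \<le> (\<Sum>i=1..N. w i)"
      using i w by (intro member_le_sum) (auto simp: weight_simplex_def PiE_iff)
    also have "\<dots> = 1" using w by (simp add: weight_simplex_def)
    finally have "w i * p i \<le> p i" using p[OF i] mult_right_mono[of "w i" 1 "p i"] by simp
    also have "\<dots> \<le> (\<Sum>i=1..N. p i)"
      using i p by (intro member_le_sum) auto
    finally show ?thesis .
  qed
  then show ?thesis
    unfolding weighted_max_def using assms(1) by (subst Max_le_iff) auto
qed

lemma lower_envelope_nonneg:
  assumes "N \<ge> 1" and "finite P" and "P \<noteq> {}" and "P \<subseteq> pos_orthant N" and "w \<in> weight_simplex N"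
  shows "0 \<le> lower_envelope N P w"
  unfolding lower_envelope_def using assms weighted_max_nonneg by (subst Min_ge_iff) auto

text \<open>The first coordinate alone bounds every maximum from below by a positive number. This
  makes \<open>1 / lower_envelope N P w\<close> a genuine positive radius.\<close>

lemma lower_envelope_pos:
  assumes "N \<ge> 1" and "finite P" and "P \<noteq> {}" and "P \<subseteq> pos_orthant N"
    and w: "\<And>i. i \<in> {1..N} \<Longrightarrow> 0 < w i"
  shows "0 < lower_envelope N P w"
proof -
  have "0 < w 1 * p 1" if "p \<in> P" for p
    using that assms by (intro mult_pos_pos) (auto simp: pos_orthant_def PiE_iff)
  then show ?thesis
    unfolding lower_envelope_def weighted_max_def
    using assms by (subst Min_gr_iff; simp) (subst Max_gr_iff; force)
qed

text \<open>A single \<open>p\<close> of \<open>P\<close> bounds the envelope uniformly on the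
  simplex, which has finite volume. Integrability of the kernel over the unbounded region is later
  deduced from this.\<close>

lemma nn_integral_lower_envelope_finite:
  assumes "N \<ge> 1" and "finite P" and "P \<noteq> {}" and "P \<subseteq> pos_orthant N"
  shows "(\<integral>\<^sup>+w. ennreal (lower_envelope N P w) * indicator (weight_simplex N) w \<partial>hyperplane_measure N) < \<infinity>"
proof -
  obtain p where p: "p \<in> P" using assms by blast
  have "lower_envelope N P w \<le> (\<Sum>i=1..N. p i)" if "w \<in> weight_simplex N" for w
  proof -
    have "lower_envelope N P w \<le> weighted_max N p w"
      unfolding lower_envelope_def using p assms by (intro Min_le) auto
    also have "\<dots> \<le> (\<Sum>i=1..N. p i)"
      using that p assms by (intro weighted_max_le_sum) auto
    finally show ?thesis .
  qed
  then have "(\<integral>\<^sup>+w. ennreal (lower_envelope N P w) * indicator (weight_simplex N) w \<partial>hyperplane_measure N)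
      \<le> (\<integral>\<^sup>+w. ennreal (\<Sum>i=1..N. p i) * indicator (weight_simplex N) w \<partial>hyperplane_measure N)"
    by (intro nn_integral_mono) (auto simp: indicator_def intro!: ennreal_leI)
  also have "\<dots> = ennreal (\<Sum>i=1..N. p i) * ennreal (1 / fact (N - 1))"
    using sets_weight_simplex
    by (subst nn_integral_cmult_indicator)
       (simp_all add: emeasure_weight_simplex[OF assms(1)], simp add: hyperplane_measure_def)
  also have "\<dots> < \<infinity>"
    by (simp add: ennreal_mult_less_top)
  finally show ?thesis .
qed

section \<open>Integration along a single ray\<close>

lemma sets_orthant_minus_boxes:
  assumes "finite Q"
  shows "pos_orthant N - anchored_box_union N Q \<in> sets (lebesgue_on_indices {1..N})"
  unfolding pos_orthant_def anchored_box_union_def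
  using assms by (intro sets.Diff sets.finite_UN sets_PiM_I_finite) auto

text \<open>If all coordinates of \<open>w\<close> are positive, the integrand reduces to
  \<open>1 / r ^ 2\<close> beyond the radius \<open>1 / lower_envelope N P w\<close>. Otherwise
  \<open>w0\<close> forces a negative coordinate: \<open>w\<close> is then outside the simplex, its
  ray misses the open orthant, and both sides are 0.\<close>

lemma nn_integral_ray:
  assumes "N \<ge> 1" and "finite P" and "P \<noteq> {}" and "P \<subseteq> pos_orthant N"
    and w1: "(\<Sum>i=1..N. w i) = 1" and w0: "\<forall>i\<in>{1..N}. w i \<noteq> 0" and wE: "w \<in> extensional {1..N}"
  defines "A \<equiv> pos_orthant N - anchored_box_union N (recip N ` P)"
  shows "(\<integral>\<^sup>+r. ennreal (r ^ (N - 1)) *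
            (ennreal (1 / (\<Sum>j=1..N. (\<lambda>i\<in>{1..N}. r * w i) j) ^ (N + 1)) * indicator A (\<lambda>i\<in>{1..N}. r * w i))
            * indicator {0<..} r \<partial>lborel)
       = ennreal (lower_envelope N P w) * indicator (weight_simplex N) w"
    (is "?lhs = ?rhs")
proof (cases "\<forall>i\<in>{1..N}. 0 < w i")
  case True
  let ?t = "lower_envelope N P w"
  have t: "?t > 0" using True assms by (intro lower_envelope_pos) auto
  have "?lhs = (\<integral>\<^sup>+r. ennreal (1 / r ^ 2) * indicator {1 / ?t<..} r \<partial>lborel)"
  proof (rule nn_integral_cong)
    fix r :: real
    have s: "(\<Sum>j=1..N. (\<lambda>i\<in>{1..N}. r * w i) j) = r"
      using w1 by (simp add: sum_distrib_left[symmetric])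
    show "ennreal (r ^ (N - 1)) *
            (ennreal (1 / (\<Sum>j=1..N. (\<lambda>i\<in>{1..N}. r * w i) j) ^ (N + 1)) * indicator A (\<lambda>i\<in>{1..N}. r * w i))
            * indicator {0<..} r = ennreal (1 / r ^ 2) * indicator {1 / ?t<..} r"
    proof (cases "r > 0")
      case r: True
      have "indicator A (\<lambda>i\<in>{1..N}. r * w i) = (indicator {1 / ?t<..} r :: ennreal)"
        using one_less_mult_lower_envelope_iff[OF assms(1-4) r, of w] True t
        by (auto simp: indicator_def A_def field_simps)
      moreover have "ennreal (r ^ (N - 1)) * ennreal (1 / r ^ (N + 1)) = ennreal (1 / r ^ 2)"
      proof -
        \<comment> \<open>The subtraction in \<open>N - 1\<close> is truncated, so the exponents add
          up only because \<open>N \<ge> 1\<close>.\<close>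
        have "r ^ (N + 1) = r ^ (N - 1) * r ^ 2"
          using assms(1) by (simp flip: power_add)
        then show ?thesis using r by (simp flip: ennreal_mult)
      qed
      ultimately show ?thesis
        unfolding s using r by (simp add: mult.assoc[symmetric])
    next
      case False
      \<comment> \<open>For \<open>r \<le> 0\<close> the right-hand indicator must vanish as well;
        it does since \<open>1 / ?t\<close> is positive.\<close>
      moreover have "\<not> 1 / ?t < r"
        using False t by (smt (verit) divide_pos_pos)
      ultimately show ?thesis by simp
    qed
  qed
  also have "\<dots> = ennreal ?t"
    using t by (subst nn_integral_inverse_square_tail) auto
  also have "\<dots> = ?rhs"
    using True w1 wE by (auto simp: weight_simplex_def PiE_iff indicator_def less_imp_le)
  finally show ?thesis .
next
  case False
  then obtain i where i: "i \<in> {1..N}" "w i < 0"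
    using w0 by (force simp: not_less)
  then have "w \<notin> weight_simplex N"
    by (force simp: weight_simplex_def PiE_iff)
  moreover have "(\<lambda>i\<in>{1..N}. r * w i) \<notin> A" if "r > 0" for r
  proof
    assume "(\<lambda>i\<in>{1..N}. r * w i) \<in> A"
    then have "0 < r * w i" using i by (auto simp: A_def pos_orthant_def PiE_iff)
    with i that show False by (simp add: zero_less_mult_iff)
  qed
  then have "?lhs = (\<integral>\<^sup>+r. 0 \<partial>(lborel :: real measure))"
    by (intro nn_integral_cong) (auto simp: indicator_def)
  ultimately show ?thesis by simp
qed

section \<open>The integral identity, from nonnegative to Lebesgue integrals\<close>

theorem theorem4:
  fixes N :: nat and P :: "(nat \<Rightarrow> real) set"
  assumes "N \<ge> 2"
    and "finite P" and "P \<noteq> {}" and "P \<subseteq> pos_orthant N"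
  shows "set_integrable (lebesgue_on_indices {1..N})
           (pos_orthant N - anchored_box_union N (recip N ` P))
           (\<lambda>x. 1 / (\<Sum>i=1..N. x i) ^ (N + 1))
       \<and> R2 N P =
           (LINT x:pos_orthant N - anchored_box_union N (recip N ` P)|lebesgue_on_indices {1..N}.
             1 / (\<Sum>i=1..N. x i) ^ (N + 1))"
proof -
  define A where "A = pos_orthant N - anchored_box_union N (recip N ` P)"
  let ?L = "lebesgue_on_indices {1..N}" and ?H = "hyperplane_measure N"
  let ?f = "\<lambda>x. 1 / (\<Sum>i=1..N. x i) ^ (N + 1)"
  have N: "N \<ge> 1" using assms(1) by simp
  note P = N assms(2-4)
  have A [measurable]: "A \<in> sets ?L"
    unfolding A_def using assms(2) by (intro sets_orthant_minus_boxes) simp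
  \<comment> \<open>This yields both the support condition for the cone coordinates and the
    nonnegativity of the integrand.\<close>
  have pos: "0 < (\<Sum>i=1..N. x i)" if "x \<in> A" for x
    using that N by (intro sum_pos) (auto simp: A_def pos_orthant_def PiE_iff)
  \<comment> \<open>The identity is first proved in \<open>ennreal\<close>, where Tonelli requires
    no prior integrability.\<close>
  have "(\<integral>\<^sup>+x. ennreal (?f x) * indicator A x \<partial>?L)
      = (\<integral>\<^sup>+w. (\<integral>\<^sup>+r. ennreal (r ^ (N - 1)) *
            (ennreal (?f (\<lambda>i\<in>{1..N}. r * w i)) * indicator A (\<lambda>i\<in>{1..N}. r * w i))
            * indicator {0<..} r \<partial>lborel) \<partial>?H)"
  proof (rule nn_integral_cone_coordinates[OF N])
    show "(\<lambda>x. ennreal (?f x) * indicator A x) \<in> borel_measurable ?L"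
      by measurable
    show "ennreal (?f x) * indicator A x = 0" if "(\<Sum>i=1..N. x i) \<le> 0" for x
      using that pos[of x] by (auto simp: indicator_def)
  qed
  also have "\<dots> = (\<integral>\<^sup>+w. ennreal (lower_envelope N P w) * indicator (weight_simplex N) w \<partial>?H)"
  proof (rule nn_integral_cong_AE)
    \<comment> \<open>Membership in \<open>weight_simplex N\<close> includes being
      \<open>undefined\<close> off \<open>{1..N}\<close>; the underlying space of the measure
      guarantees it.\<close>
    have "AE w in ?H. w \<in> extensional {1..N}"
      by (rule AE_I2) (simp add: hyperplane_measure_def space_PiM PiE_def)
    then show "AE w in ?H. (\<integral>\<^sup>+r. ennreal (r ^ (N - 1)) *
            (ennreal (?f (\<lambda>i\<in>{1..N}. r * w i)) * indicator A (\<lambda>i\<in>{1..N}. r * w i))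
            * indicator {0<..} r \<partial>lborel)
        = ennreal (lower_envelope N P w) * indicator (weight_simplex N) w"
      using AE_hyperplane_coordinate_neq_0[OF assms(1)] AE_hyperplane_sum_eq_1[OF N]
      by eventually_elim (unfold A_def, rule nn_integral_ray[OF P])
  qed
  finally have eq: "(\<integral>\<^sup>+x. ennreal (?f x) * indicator A x \<partial>?L)
      = (\<integral>\<^sup>+w. ennreal (lower_envelope N P w) * indicator (weight_simplex N) w \<partial>?H)" .
  have eqL: "(\<integral>\<^sup>+x. ennreal (?f x) * indicator A x \<partial>?L) = (\<integral>\<^sup>+x. ennreal (indicator A x *\<^sub>R ?f x) \<partial>?L)"
    by (intro nn_integral_cong) (auto simp: indicator_def)
  have eqH: "(\<integral>\<^sup>+w. ennreal (lower_envelope N P w) * indicator (weight_simplex N) w \<partial>?H)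
      = (\<integral>\<^sup>+w. ennreal (indicator (weight_simplex N) w *\<^sub>R lower_envelope N P w) \<partial>?H)"
    by (intro nn_integral_cong) (auto simp: indicator_def)
  have mL: "(\<lambda>x. indicator A x *\<^sub>R ?f x) \<in> borel_measurable ?L"
    by measurable
  have mH: "(\<lambda>w. indicator (weight_simplex N) w *\<^sub>R lower_envelope N P w) \<in> borel_measurable ?H"
    using borel_measurable_lower_envelope[OF assms(2)] sets_weight_simplex
    by (simp add: hyperplane_measure_def)
  have nL: "0 \<le> indicator A x *\<^sub>R ?f x" for x
    using pos[of x] by (auto simp: indicator_def less_imp_le)
  have nH: "0 \<le> indicator (weight_simplex N) w *\<^sub>R lower_envelope N P w" for w
    using lower_envelope_nonneg[OF P, of w] by (auto simp: indicator_def)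
  \<comment> \<open>The integral of a non-integrable function is 0 by convention, so integrability
    is a claim of its own. Finiteness is carried over by \<open>eq\<close> from the simplex
    side.\<close>
  have "set_integrable ?L A ?f"
    unfolding set_integrable_def
    using mL nL nn_integral_lower_envelope_finite[OF P] eq eqL
    by (intro integrableI_nonneg) auto
  \<comment> \<open>Both integrands are nonnegative, so each integral is the real value of its
    \<open>ennreal\<close> counterpart, and these agree by \<open>eq\<close>.\<close>
  moreover have "R2 N P = (LINT x:A|?L. ?f x)"
    unfolding R2_def set_lebesgue_integral_def
    using eq eqL eqH
    by (simp only: integral_eq_nn_integral[OF mL AE_I2[OF nL]] integral_eq_nn_integral[OF mH AE_I2[OF nH]])
  ultimately show ?thesis
    unfolding A_def by blast
qed

end
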